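(* Let $f,g,h$ be monotone functions on binary relations over a set $X$ and let $m\ge1$ be an integer. Suppose $g\subseteq\mathrm{id}$, $f$ is $g$-compatible, $f$ is $(h\circ g^m),h$-compatible (i.e. $f\circ((h\circ g^m)\cap h)\subseteq h\circ f$), and $$\forall n\in\mathbb N,\quad f^n\circ\Big(\bigcup_{i\le mn+1}f^i\Big)\subseteq\bigcup_{i\in\mathbb N}f^i .$$ Then $f$ is $(g\cap h)$-sound via $f^\omega$: for every relation $\mathcal R$, $\mathcal R\subseteq(g\cap h)(f(\mathcal R))$ implies $f^\omega(\mathcal R)\subseteq(g\cap h)(f^\omega(\mathcal R))$ (and $f^\omega$ is extensive).
   Context: Fix a set $X$. A function on relations is a map from the set of binary relations on $X$ to itself. For such functions, $(f\circ g)(\mathcal R)=f(g(\mathcal R))$, intersections and (indexed) unions are pointwise, and $f\subseteq g$ means $f(\mathcal R)\subseteq g(\mathcal R)$ for all $\mathcal R$. $f^0=\mathrm{id}$, $f^{n+1}=f\circ f^n$, $f^\omega(\mathcal R)=\bigcup_{n\in\mathbb N}f^n(\mathcal R)$. $f$ is monotone if $\mathcal R\subseteq\mathcal S$ implies $f(\mathcal R)\subseteq f(\mathcal S)$; extensive if $\mathrm{id}\subseteq f$. $f$ is $g$-compatible if $f\circ g\subseteq g\circ f$; $f$ is $g,h$-compatible if $f\circ(g\cap h)\subseteq h\circ f$. $f$ is $g$-sound via $f'$ if $f'$ is extensive and for every $\mathcal R$, $\mathcal R\subseteq g(f(\mathcal R))$ implies $f'(\mathcal R)\subseteq g(f'(\mathcal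 R))$. *)

theory Defs
  imports Main "HOL-Library.FuncSet"
begin

(* The set X is an explicit carrier, possibly empty. A function on relations is given by a
   HOL function of type 'a rel => 'a rel, of which only the restriction to the relations on X
   is meaningful; hence inclusion and monotonicity are relativised to these.  Composition,
   iterates and pointwise (binary or indexed) intersection and union need no relativisation
   and are the library's (o), (^^), inf and SUP on functions. *)

definition rels_on :: "'a set \<Rightarrow> 'a rel set" where
  "rels_on X = Pow (X \<times> X)"

definition rel_function :: "'a set \<Rightarrow> ('a rel \<Rightarrow> 'a rel) \<Rightarrow> bool" where
  "rel_function X f \<longleftrightarrow> f \<in> rels_on X \<rightarrow> rels_on X"

definition fun_subseteq :: "'a set \<Rightarrow> ('a rel \<Rightarrow> 'a rel) \<Rightarrow> ('a rel \<Rightarrow> 'a rel) \<Rightarrow> bool" where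
  "fun_subseteq X f g \<longleftrightarrow> (\<forall>R \<in> rels_on X. f R \<subseteq> g R)"

definition extensive :: "'a set \<Rightarrow> ('a rel \<Rightarrow> 'a rel) \<Rightarrow> bool" where
  "extensive X f \<longleftrightarrow> fun_subseteq X id f"

definition omega_iterate :: "('a rel \<Rightarrow> 'a rel) \<Rightarrow> 'a rel \<Rightarrow> 'a rel" where
  "omega_iterate f R = (\<Union>n::nat. (f ^^ n) R)"

(* compatible X g f: f is g-compatible;  compatible2 X g h f: f is g,h-compatible *)
definition compatible :: "'a set \<Rightarrow> ('a rel \<Rightarrow> 'a rel) \<Rightarrow> ('a rel \<Rightarrow> 'a rel) \<Rightarrow> bool" where
  "compatible X g f \<longleftrightarrow> fun_subseteq X (f \<circ> g) (g \<circ> f)"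

definition compatible2 ::
  "'a set \<Rightarrow> ('a rel \<Rightarrow> 'a rel) \<Rightarrow> ('a rel \<Rightarrow> 'a rel) \<Rightarrow> ('a rel \<Rightarrow> 'a rel) \<Rightarrow> bool" where
  "compatible2 X g h f \<longleftrightarrow> fun_subseteq X (f \<circ> inf g h) (h \<circ> f)"

(* sound_via X g f f': f is g-sound via f' *)
definition sound_via ::
  "'a set \<Rightarrow> ('a rel \<Rightarrow> 'a rel) \<Rightarrow> ('a rel \<Rightarrow> 'a rel) \<Rightarrow> ('a rel \<Rightarrow> 'a rel) \<Rightarrow> bool" where
  "sound_via X g f f' \<longleftrightarrow>
     extensive X f' \<and> (\<forall>R \<in> rels_on X. R \<subseteq> g (f R) \<longrightarrow> f' R \<subseteq> g (f' R))"

end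

theory Submission imports Defs begin

text \<open>
  Since \<open>g \<subseteq> id\<close>, the hypothesis \<open>R \<subseteq> (g \<inter> h) (f R)\<close> makes \<open>f\<^sup>n R\<close> an increasing chain, and
  compatibility gives \<open>f\<^sup>n R \<subseteq> g\<^sup>k (f\<^sup>n\<^sup>+\<^sup>k R)\<close> for all \<open>n\<close> and \<open>k\<close>.  If \<open>f\<^sup>n R \<subseteq> h S\<close> for an iterate
  \<open>S\<close> of \<open>R\<close>, then \<open>S \<subseteq> g\<^sup>m (f\<^sup>m S)\<close>, so that \<open>f\<^sup>n\<^sup>+\<^sup>1 R \<subseteq> h (f\<^sup>m\<^sup>+\<^sup>1 S)\<close> by the second compatibility.
  Hence \<open>f\<^sup>n R \<subseteq> h (f\<^sup>n (f\<^sup>m\<^sup>n\<^sup>+\<^sup>1 R))\<close>.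
\<close>

lemma rel_function_funpow:
  assumes "rel_function X f"
  shows "rel_function X (f ^^ n)"
  using assms by (induction n) (auto simp: rel_function_def)

lemma mono_on_funpow:
  assumes "rel_function X f" and "mono_on (rels_on X) f"
  shows "mono_on (rels_on X) (f ^^ n)"
proof (induction n)
  case 0
  show ?case by (simp add: mono_on_def)
next
  case (Suc n)
  \<comment> \<open>Monotonicity is relativised to relations over \<open>X\<close>, so the outer
    \<open>f\<close> can be applied only once its argument lies there.\<close>
  have "(f ^^ n) R \<in> rels_on X" if "R \<in> rels_on X" for R
    using rel_function_funpow[OF assms(1), of n] that by (auto simp: rel_function_def)
  with Suc assms(2) show ?case
    unfolding mono_on_def by auto
qed

lemma fun_subseteq_id_funpow:
  assumes "rel_function X g" and "fun_subseteq X g id"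
  shows "fun_subseteq X (g ^^ n) id"
proof (induction n)
  case 0
  show ?case by (simp add: fun_subseteq_def)
next
  case (Suc n)
  have "(g ^^ n) R \<in> rels_on X" if "R \<in> rels_on X" for R
    using rel_function_funpow[OF assms(1), of n] that by (auto simp: rel_function_def)
  with Suc assms(2) show ?case
    unfolding fun_subseteq_def by fastforce
qed

lemma extensive_omega_iterate: "extensive X (omega_iterate f)"
proof -
  have "R = (f ^^ 0) R" for R by simp
  then show ?thesis
    unfolding extensive_def fun_subseteq_def omega_iterate_def id_apply by blast
qed

theorem theorem40:
  fixes X :: "'a set"
    and f g h :: "'a rel \<Rightarrow> 'a rel"
    and m :: nat
  assumes "rel_function X f" and "rel_function X g" and "rel_function X h"
    and "mono_on (rels_on X) f" and "mono_on (rels_on X) g" and "mono_on (rels_on X) h"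
    and "m \<ge> 1"
    and "fun_subseteq X g id"
    and "compatible X g f"
    and "compatible2 X (h \<circ> g ^^ m) h f"
    and "\<And>n::nat. fun_subseteq X (f ^^ n \<circ> (SUP i\<in>{..m * n + 1}. f ^^ i)) (SUP i::nat. f ^^ i)"
  shows "sound_via X (inf g h) f (omega_iterate f)"
proof -
  note f_fun = assms(1) and g_fun = assms(2) and f_mono = assms(4) and g_mono = assms(5)
    and h_mono = assms(6) and g_le = assms(8) and g_compat = assms(9) and h_compat = assms(10)
  have g_rel: "g A \<in> rels_on X" if "A \<in> rels_on X" for A
    using g_fun that by (auto simp: rel_function_def)
  have fp_rel: "(f ^^ n) A \<in> rels_on X" if "A \<in> rels_on X" for A n
    using rel_function_funpow[OF f_fun, of n] that by (auto simp: rel_function_def)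
  have gp_rel: "(g ^^ n) A \<in> rels_on X" if "A \<in> rels_on X" for A n
    using rel_function_funpow[OF g_fun, of n] that by (auto simp: rel_function_def)
  have "omega_iterate f R \<subseteq> inf g h (omega_iterate f R)"
    if R: "R \<in> rels_on X" and progress: "R \<subseteq> inf g h (f R)" for R
  proof -
    let ?W = "omega_iterate f R"
    have Fn: "(f ^^ n) R \<in> rels_on X" for n
      using fp_rel R by blast
    have W: "?W \<in> rels_on X"
      using Fn by (auto simp: omega_iterate_def rels_on_def)
    have F_le_W: "(f ^^ n) R \<subseteq> ?W" for n
      by (auto simp: omega_iterate_def)
    have F_le_g: "(f ^^ n) R \<subseteq> g ((f ^^ Suc n) R)" for n
    proof (induction n)
      case 0
      show ?case using progress by auto
    next
      case (Suc n)
      have "(f ^^ Suc n) R \<subseteq> f (g ((f ^^ Suc n) R))"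
        using mono_onD[OF f_mono Fn g_rel[OF Fn] Suc] by simp
      also have "\<dots> \<subseteq> g (f ((f ^^ Suc n) R))"
        using g_compat Fn[of "Suc n"] unfolding compatible_def fun_subseteq_def by auto
      finally show ?case by simp
    qed
    have F_le_gp: "(f ^^ n) R \<subseteq> (g ^^ k) ((f ^^ (n + k)) R)" for n k
    proof (induction k)
      case 0
      show ?case by simp
    next
      case (Suc k)
      \<comment> \<open>The new factor \<open>g\<close> enters innermost, by \<open>F_le_g\<close>
        at the iterate of index \<open>n + k\<close>.\<close>
      have "(g ^^ k) ((f ^^ (n + k)) R) \<subseteq> (g ^^ k) (g ((f ^^ Suc (n + k)) R))"
        using mono_onD[OF mono_on_funpow[OF g_fun g_mono] Fn g_rel[OF Fn] F_le_g] .
      with Suc show ?case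
        by (simp add: funpow_swap1)
    qed
    \<comment> \<open>The index is 1 at the start, from the progress hypothesis. Each step adds
      \<open>m + 1\<close>: \<open>m\<close> to gain \<open>g ^^ m\<close>, and one for the outer
      \<open>f\<close>.\<close>
    have F_le_h: "(f ^^ n) R \<subseteq> h ((f ^^ (n + (m * n + 1))) R)" for n
    proof (induction n)
      case 0
      show ?case using progress by auto
    next
      case (Suc n)
      let ?S = "(f ^^ (n + (m * n + 1))) R" and ?T = "(f ^^ (n + (m * n + 1) + m)) R"
      have "h ?S \<subseteq> h ((g ^^ m) ?T)"
        using mono_onD[OF h_mono Fn gp_rel[OF Fn] F_le_gp] .
      \<comment> \<open>Compatibility asks for both members of the intersection at the same argument
        \<open>?T\<close>; the bound by \<open>h ?T\<close> follows because \<open>g ^^ m\<close>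
        shrinks relations.\<close>
      moreover have "h ((g ^^ m) ?T) \<subseteq> h ?T"
      proof -
        have "(g ^^ m) ?T \<subseteq> ?T"
          using fun_subseteq_id_funpow[OF g_fun g_le, of m] Fn
          unfolding fun_subseteq_def id_apply by blast
        then show ?thesis
          using mono_onD[OF h_mono gp_rel[OF Fn] Fn] by blast
      qed
      ultimately have le: "(f ^^ n) R \<subseteq> inf (h \<circ> g ^^ m) h ?T"
        using Suc by auto
      have "h ?T \<in> rels_on X"
        using assms(3) Fn unfolding rel_function_def by blast
      then have "inf (h \<circ> g ^^ m) h ?T \<in> rels_on X"
        by (auto simp: rels_on_def)
      then have "f ((f ^^ n) R) \<subseteq> f (inf (h \<circ> g ^^ m) h ?T)"
        using mono_onD[OF f_mono Fn _ le] by blast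
      also have "\<dots> \<subseteq> h (f ?T)"
        using h_compat Fn unfolding compatible2_def fun_subseteq_def by (metis comp_apply)
      also have "f ?T = (f ^^ (Suc n + (m * Suc n + 1))) R"
        by (simp add: ac_simps)
      finally show ?case by simp
    qed
    \<comment> \<open>Each iterate lies below \<open>g\<close>, and below \<open>h\<close>, of a
      later iterate, hence of the union \<open>?W\<close> by monotonicity. Taking the union over
      \<open>n\<close> on the left gives the claim.\<close>
    have "(f ^^ n) R \<subseteq> g ?W" for n
      using F_le_g mono_onD[OF g_mono Fn W F_le_W] by blast
    moreover have "(f ^^ n) R \<subseteq> h ?W" for n
      using F_le_h mono_onD[OF h_mono Fn W F_le_W] by blast
    ultimately show ?thesis
      unfolding omega_iterate_def[of f R] by auto
  qed
  then show ?thesis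
    using extensive_omega_iterate unfolding sound_via_def by blast
qed

end
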